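(* Let $y_1,\dots,y_M\in\mathbb{R}^3$ be pairwise distinct, let $\alpha=(\alpha_1,\dots,\alpha_M)\in\mathbb{C}^M$ with $\operatorname{Im}\alpha_j\ge 0$ for all $j$, and let $k>0$ be such that the matrix $P(k,\alpha)$ is invertible. Let $\{\theta_n:n\in\mathbb{N}\}\subset\mathbb{S}^2$ be a countable set of directions with the following property: if an analytic function on $\mathbb{S}^2$ vanishes at $\theta_n$ for all $n\in\mathbb{N}$, then it vanishes identically on $\mathbb{S}^2$. Let $K\subset\mathbb{R}^3$ be a compact set containing $y_1,\dots,y_M$. For $N\in\mathbb{N}$ with $N\ge M$ and $z\in\mathbb{R}^3$ set $$\phi_z=\big(e^{-ik\theta_1\cdot z},\dots,e^{-ik\theta_N\cdot z}\big)^T\in\mathbb{C}^N,$$ let $F\in\mathbb{C}^{N\times N}$ be the matrix $F_{jl}=u^\infty(\theta_j,\theta_l)$, $1\le j,l\le N$, let $\mathcal{P}$ be the orthogonal projection of $\mathbb{C}^N$ onto $\operatorname{Range}(F)^\perp$, and define the test function $$I_z=\frac{1}{|\mathcal{P}\phi_z|},$$ with the convention $I_z=+\infty$ if $\mathcal{P}\phi_z=0$. Then there exists $N_0\in\mathbb{N}$ such that for all $N\ge N_0$ (with $N\ge M$) and for all $z\in K$, $$z\in\{y_1,\dots,y_M\}\iff I_z=+\infty.$$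
   Context: $\mathbb{S}^2=\{x\in\mathbb{R}^3:|x|=1\}$ is the unit sphere; "analytic function on $\mathbb{S}^2$" means complex-valued real-analytic function; $|\cdot|$ on $\mathbb{C}^N$ is the Euclidean norm. $\Phi_k(x,y)=\dfrac{e^{ik|x-y|}}{4\pi|x-y|}$ for $x\ne y$ in $\mathbb{R}^3$ is the outgoing fundamental solution of the Helmholtz equation. The points $y_1,\dots,y_M$ are the positions of point scatterers with scattering coefficients $\alpha_1,\dots,\alpha_M\in\mathbb{C}$, and $k>0$ is the wave number. The matrix $P(k,\alpha)\in\mathbb{C}^{M\times M}$ is defined by $$[P(k,\alpha)]_{m,j}=\begin{cases}\Phi_k(y_m,y_j), & m\ne j,\\ \dfrac{ik}{4\pi}-\alpha_j, & m=j.\end{cases}$$ For an incident plane wave $e^{ikx\cdot d}$ with direction $d\in\mathbb{S}^2$, the scattered field is $u^s(x,d)=-\sum_{m,j=1}^M [P(k,\alpha)^{-1}]_{m,j}e^{ik y_j\cdot d}\Phi_k(x,y_m)$, and its far-field pattern is $$u^\infty(\hat x,d)=-\sum_{m,j=1}^M [P(k,\alpha)^{-1}]_{m,j}\,e^{ik(y_j\cdot d-\hat x\cdot y_m)},\qquad \hat x,d\in\mathbb{S}^2.$$ *)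

theory Defs
  imports
    "HOL-Analysis.Analysis"
    "Jordan_Normal_Form.Gauss_Jordan_Elimination"
begin

text \<open>Both libraries use these symbols; here they keep their HOL-Analysis meaning
  (inner product and components in \<open>real ^ 'n\<close>).\<close>

no_notation Matrix.scalar_prod (infix "\<bullet>" 70)
no_notation Matrix.vec_index (infixl "$" 100)

text \<open>Real-analyticity of a complex-valued function of several real variables at a point:
  on a ball around the point, the function is the sum of an (absolutely convergent)
  power series over multi-indices \<open>\<nu> :: 'n \<Rightarrow> nat\<close>.\<close>

definition real_analytic_at :: "(real ^ 'n \<Rightarrow> complex) \<Rightarrow> real ^ 'n \<Rightarrow> bool" where
  "real_analytic_at f p \<longleftrightarrow>
     (\<exists>c :: ('n \<Rightarrow> nat) \<Rightarrow> complex. \<exists>r>0. \<forall>x\<in>ball p r.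
        ((\<lambda>\<nu>. c \<nu> * of_real (\<Prod>i\<in>UNIV. (x $ i - p $ i) ^ \<nu> i)) has_sum f x) UNIV)"

text \<open>Analyticity on a subset such as the unit sphere: local extendability to
  real-analytic functions on open subsets of the ambient space. As the sphere is an embedded
  real-analytic submanifold, this is analyticity on the sphere as a real-analytic manifold.
  Only the values of \<open>f\<close> on \<open>S\<close> matter.\<close>

definition real_analytic_on :: "(real ^ 'n \<Rightarrow> complex) \<Rightarrow> (real ^ 'n) set \<Rightarrow> bool" where
  "real_analytic_on f S \<longleftrightarrow>
     (\<forall>p\<in>S. \<exists>U g. open U \<and> p \<in> U \<and> (\<forall>q\<in>U. real_analytic_at g q) \<and> (\<forall>x\<in>S \<inter> U. f x = g x))"

definition helmholtz_fs :: "real \<Rightarrow> real ^ 3 \<Rightarrow> real ^ 3 \<Rightarrow> complex" where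
  "helmholtz_fs k x y = exp (\<i> * of_real (k * norm (x - y))) / of_real (4 * pi * norm (x - y))"

text \<open>Indices start at \<open>0\<close> throughout: the scatterers are \<open>y 0, \<dots>, y (M - 1)\<close>
  and the first \<open>N\<close> directions are \<open>\<theta> 0, \<dots>, \<theta> (N - 1)\<close>.\<close>

definition foldy_mat ::
    "real \<Rightarrow> nat \<Rightarrow> (nat \<Rightarrow> real ^ 3) \<Rightarrow> (nat \<Rightarrow> complex) \<Rightarrow> complex mat" where
  "foldy_mat k M y \<alpha> = mat M M (\<lambda>(m, j).
     if m \<noteq> j then helmholtz_fs k (y m) (y j) else \<i> * of_real k / of_real (4 * pi) - \<alpha> j)"

text \<open>The value is meaningful only if \<open>foldy_mat k M y \<alpha>\<close> is invertible, i.e. if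
  \<open>mat_inverse\<close> does not return \<open>None\<close>.\<close>

definition far_field ::
    "real \<Rightarrow> nat \<Rightarrow> (nat \<Rightarrow> real ^ 3) \<Rightarrow> (nat \<Rightarrow> complex) \<Rightarrow> real ^ 3 \<Rightarrow> real ^ 3 \<Rightarrow> complex" where
  "far_field k M y \<alpha> xh d =
     - (\<Sum>m<M. \<Sum>j<M. the (mat_inverse (foldy_mat k M y \<alpha>)) $$ (m, j) *
          exp (\<i> * of_real (k * (y j \<bullet> d - xh \<bullet> y m))))"

definition far_field_mat ::
    "real \<Rightarrow> nat \<Rightarrow> (nat \<Rightarrow> real ^ 3) \<Rightarrow> (nat \<Rightarrow> complex) \<Rightarrow> (nat \<Rightarrow> real ^ 3) \<Rightarrow> nat \<Rightarrow> complex mat"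
  where
  "far_field_mat k M y \<alpha> \<theta> N = mat N N (\<lambda>(j, l). far_field k M y \<alpha> (\<theta> j) (\<theta> l))"

definition steering_vec :: "real \<Rightarrow> (nat \<Rightarrow> real ^ 3) \<Rightarrow> nat \<Rightarrow> real ^ 3 \<Rightarrow> complex Matrix.vec" where
  "steering_vec k \<theta> N z = Matrix.vec N (\<lambda>j. exp (- \<i> * of_real (k * (\<theta> j \<bullet> z))))"

definition mat_range :: "complex mat \<Rightarrow> complex Matrix.vec set" where
  "mat_range A = {A *\<^sub>v v | v. v \<in> carrier_vec (dim_col A)}"

definition cvec_norm :: "complex Matrix.vec \<Rightarrow> real" where
  "cvec_norm v = sqrt (\<Sum>i<dim_vec v. (cmod (vec_index v i))\<^sup>2)"

text \<open>Orthogonality is with respect to the Hermitian inner product \<open>\<bullet>c\<close>.\<close>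

definition orth_compl :: "nat \<Rightarrow> complex Matrix.vec set \<Rightarrow> complex Matrix.vec set" where
  "orth_compl n W = {w \<in> carrier_vec n. \<forall>v\<in>W. w \<bullet>c v = 0}"

text \<open>Orthogonal projection of \<open>\<complex>\<^sup>n\<close> onto a linear subspace \<open>W\<close>.\<close>

definition orth_proj :: "nat \<Rightarrow> complex Matrix.vec set \<Rightarrow> complex Matrix.vec \<Rightarrow> complex Matrix.vec" where
  "orth_proj n W v = (THE p. p \<in> W \<and> v - p \<in> orth_compl n W)"

definition test_fun ::
    "real \<Rightarrow> nat \<Rightarrow> (nat \<Rightarrow> real ^ 3) \<Rightarrow> (nat \<Rightarrow> complex) \<Rightarrow> (nat \<Rightarrow> real ^ 3) \<Rightarrow> nat \<Rightarrow> real ^ 3 \<Rightarrow> ereal"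
  where
  "test_fun k M y \<alpha> \<theta> N z =
     (let p = orth_proj N (orth_compl N (mat_range (far_field_mat k M y \<alpha> \<theta> N)))
                (steering_vec k \<theta> N z)
      in if p = 0\<^sub>v N then \<infinity> else ereal (1 / cvec_norm p))"

end

theory Submission
  imports
    Defs
    "Jordan_Normal_Form.Determinant"
    "HOL-Complex_Analysis.Conformal_Mappings"
    "HOL-Real_Asymp.Real_Asymp"
begin

text \<open>Let \<open>A\<close> be the matrix whose columns are the steering vectors of the scatterers. The
  far-field matrix is \<open>- A P\<^bsup>-1\<^esup> A\<^sup>*\<close>, so if \<open>A\<close> has full column rank, its range is the range
  of \<open>A\<close>, and the test function is infinite exactly if the steering vector of \<open>z\<close> is a linear
  combination of those of the scatterers (\<open>test_fun_eq_infinity_iff\<close>). The theorem is thus a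
  statement about the functions \<open>\<phi> z x = exp (- \<i> k x \<bullet> z)\<close> on the sphere, sampled at the
  directions \<open>\<theta> n\<close>.

  For distinct points \<open>z\<close> these functions, together with their derivatives in \<open>z\<close> along a
  fixed nonzero direction, are linearly independent: restrict a linear relation to a great circle
  and continue it to complex angles, where the terms grow at different exponential rates
  (\<open>affine_plane_waves_independent_on_sphere\<close>). They are real-analytic, so by the hypothesis on
  the directions they are independent as sequences over all \<open>\<theta> n\<close>
  (\<open>affine_plane_waves_independent_on_determining_set\<close>). Finitely many entries witness the
  independence of the \<open>M\<close> waves of the scatterers (\<open>finite_dual_functionals\<close>); this gives full
  rank, and it determines the only possible coefficients of a combination as smooth functions
  \<open>C m z\<close>.

  It remains to find finitely many directions for which the conditions
  \<open>G j z = \<phi> z (\<theta> j) - (\<Sum>m<M. C m z * \<phi> (y m) (\<theta> j)) = 0\<close> force \<open>z\<close> to be a scatterer, uniformly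
  for \<open>z \<in> K\<close>. For a fixed \<open>z\<close> this is independence; uniformity is a compactness argument which
  has to exclude spurious points that converge to a scatterer as the number of directions grows.
  Such points would produce a direction in which the derivatives of all \<open>G j\<close> at the scatterer vanish,
  contradicting the independence that includes derivatives
  (\<open>common_zeros_determined_by_finitely_many\<close>).\<close>

(* As in the definitions, these symbols denote the inner product and the components of Euclidean
   vectors. *)
no_notation Matrix.scalar_prod (infix "\<bullet>" 70)
no_notation Matrix.vec_index (infixl "$" 100)

section \<open>Finitely many functionals witness linear independence\<close>

text \<open>Gaussian elimination, one sequence at a time: subtracting from the new sequence its
  projection along the functionals found so far leaves a sequence \<open>g\<close> which is nonzero by
  independence, hence nonzero at some index \<open>j0\<close>; evaluation at \<open>j0\<close>, corrected to
  annihilate the old sequences and normalised, is the new functional. So finitely many entries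
  already witness linear independence.\<close>

lemma finite_dual_functionals:
  fixes e :: "nat \<Rightarrow> nat \<Rightarrow> 'a::field"
  assumes "\<And>c. (\<And>j. (\<Sum>m<M. c m * e m j) = 0) \<Longrightarrow> \<forall>m<M. c m = 0"
  shows "\<exists>N l. \<forall>m<M. \<forall>m'<M. (\<Sum>j<N. l m j * e m' j) = (if m = m' then 1 else 0)"
  using assms
proof (induction M)
  case 0
  show ?case by simp
next
  case (Suc M)
  have "\<forall>m<M. c m = 0" if c: "\<And>j. (\<Sum>m<M. c m * e m j) = 0" for c
  proof -
    have "(\<Sum>m<Suc M. (c(M := 0)) m * e m j) = 0" for j
      using c[of j] by (simp cong: sum.cong_simp)
    from Suc.prems[OF this] show ?thesis
      by (metis fun_upd_apply less_Suc_eq nat_neq_iff)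
  qed
  from Suc.IH[OF this] obtain N l
    where l: "\<And>m m'. m < M \<Longrightarrow> m' < M \<Longrightarrow> (\<Sum>j<N. l m j * e m' j) = (if m = m' then 1 else 0)"
    by blast
  define L where "L m f = (\<Sum>j<N. l m j * f j)" for m and f :: "nat \<Rightarrow> 'a"
  have L: "L m (e m') = (if m = m' then 1 else 0)" if "m < M" "m' < M" for m m'
    using l[OF that] by (simp add: L_def)
  define g where "g j = e M j - (\<Sum>m<M. L m (e M) * e m j)" for j
  have "\<exists>j. g j \<noteq> 0"
  proof (rule ccontr)
    assume "\<not> ?thesis"
    then have g0: "g j = 0" for j by blast
    define c where "c m = (if m = M then 1 else - L m (e M))" for m
    have "(\<Sum>m<Suc M. c m * e m j) = 0" for j
    proof -
      have "(\<Sum>m<M. c m * e m j) = (\<Sum>m<M. - (L m (e M) * e m j))"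
        by (intro sum.cong) (auto simp: c_def)
      with g0[of j] show ?thesis
        by (simp add: g_def c_def sum_negf)
    qed
    from Suc.prems[OF this] have "c M = 0" by blast
    then show False by (simp add: c_def)
  qed
  then obtain j0 where j0: "g j0 \<noteq> 0" by blast
  \<comment> \<open>\<open>lM\<close> represents \<open>f \<mapsto> (f j0 - (\<Sum>m<M. L m f * e m j0)) / g j0\<close>; the
    old functionals are then corrected to annihilate \<open>e M\<close>.\<close>
  define N' where "N' = max N (Suc j0)"
  define l0 where "l0 m j = (if j < N then l m j else 0)" for m j
  define lM where "lM j = ((if j = j0 then 1 else 0) - (\<Sum>m<M. l0 m j * e m j0)) / g j0" for j
  define l' where "l' m j = (if m = M then lM j else l0 m j - L m (e M) * lM j)" for m j
  have S0: "(\<Sum>j<N'. l0 m j * f j) = L m f" for m f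
    unfolding L_def l0_def N'_def by (intro sum.mono_neutral_cong_right) auto
  have SM: "(\<Sum>j<N'. lM j * f j) = (f j0 - (\<Sum>m<M. L m f * e m j0)) / g j0" for f
  proof -
    have "(\<Sum>j<N'. lM j * f j) =
        (\<Sum>j<N'. ((if j = j0 then f j else 0) - (\<Sum>m<M. l0 m j * f j * e m j0)) / g j0)"
      by (intro sum.cong) (auto simp: lM_def field_simps sum_distrib_left sum_distrib_right)
    also have "\<dots> = ((\<Sum>j<N'. if j = j0 then f j else 0) - (\<Sum>j<N'. \<Sum>m<M. l0 m j * f j * e m j0)) / g j0"
      by (simp add: sum_divide_distrib[symmetric] sum_subtractf)
    also have "(\<Sum>j<N'. if j = j0 then f j else 0) = f j0"
      by (simp add: N'_def)
    also have "(\<Sum>j<N'. \<Sum>m<M. l0 m j * f j * e m j0) = (\<Sum>m<M. L m f * e m j0)"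
      by (subst sum.swap) (simp add: S0[symmetric] sum_distrib_right)
    finally show ?thesis .
  qed
  have SM_low: "(\<Sum>j<N'. lM j * e m' j) = 0" if "m' < M" for m'
  proof -
    have "(\<Sum>m<M. L m (e m') * e m j0) = (\<Sum>m<M. if m = m' then e m j0 else 0)"
      using that by (intro sum.cong) (auto simp: L)
    then show ?thesis using that by (simp add: SM)
  qed
  have SM_top: "(\<Sum>j<N'. lM j * e M j) = 1"
    using j0 by (simp add: SM g_def)
  have "(\<Sum>j<N'. l' m j * e m' j) = (if m = m' then 1 else 0)" if "m < Suc M" "m' < Suc M" for m m'
  proof (cases "m = M")
    case True
    then show ?thesis using that SM_low SM_top by (auto simp: l'_def less_Suc_eq)
  next
    case False
    then have "(\<Sum>j<N'. l' m j * e m' j) = (\<Sum>j<N'. l0 m j * e m' j - L m (e M) * (lM j * e m' j))"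
      by (intro sum.cong) (auto simp: l'_def algebra_simps)
    also have "\<dots> = L m (e m') - L m (e M) * (\<Sum>j<N'. lM j * e m' j)"
      by (simp only: S0 sum_subtractf sum_distrib_left)
    finally have "(\<Sum>j<N'. l' m j * e m' j) = L m (e m') - L m (e M) * (\<Sum>j<N'. lM j * e m' j)" .
    then show ?thesis using that False SM_low SM_top by (auto simp: less_Suc_eq L)
  qed
  then show ?case by blast
qed

section \<open>Common zeros of infinitely many functions on a compact set\<close>

lemma directional_derivative_zero_of_zeros_accumulating:
  fixes G :: "'a::real_normed_vector \<Rightarrow> 'b::real_normed_vector"
  assumes G: "(G has_derivative D) (at w)"
    and "z \<longlonglongrightarrow> w" and ne: "\<And>n. z n \<noteq> w" and "(\<lambda>n. sgn (z n - w)) \<longlonglongrightarrow> a"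
    and "eventually (\<lambda>n. G (z n) = G w) sequentially"
  shows "D a = 0"
proof -
  interpret D: bounded_linear D using G by (rule has_derivative_bounded_linear)
  have "filterlim z (at w) sequentially"
    using assms(2) ne by (simp add: filterlim_at)
  with G[unfolded has_derivative_at_within] 
  have "(\<lambda>n. (G (z n) - G w - D (z n - w)) /\<^sub>R norm (z n - w)) \<longlonglongrightarrow> 0"
    by (auto intro: filterlim_compose)
  moreover have "eventually (\<lambda>n. (G (z n) - G w - D (z n - w)) /\<^sub>R norm (z n - w) = - D (sgn (z n - w))) sequentially"
    using assms(5) by eventually_elim (simp add: sgn_div_norm D.scaleR)
  ultimately have "(\<lambda>n. - D (sgn (z n - w))) \<longlonglongrightarrow> 0"
    by (rule Lim_transform_eventually)
  moreover have "(\<lambda>n. - D (sgn (z n - w))) \<longlonglongrightarrow> - D a"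
    by (intro tendsto_minus D.tendsto assms)
  ultimately show ?thesis
    using LIMSEQ_unique by fastforce
qed

text \<open>Otherwise there are points \<open>z n \<in> K - Y\<close> killed by the first \<open>n\<close> functions. A
  limit point \<open>w\<close> is a common zero of all functions, so \<open>w \<in> Y\<close>; the assumptions so far do
  not exclude this. But then a limit \<open>a\<close> of the unit vectors pointing from \<open>w\<close> to \<open>z n\<close>
  is a direction in which every derivative at \<open>w\<close> vanishes, against the last assumption: this
  infinitesimal condition is what makes the finite number of functions uniform on all of \<open>K\<close>,
  also near the points of \<open>Y\<close>.\<close>

lemma common_zeros_determined_by_finitely_many:
  fixes G :: "nat \<Rightarrow> 'a::euclidean_space \<Rightarrow> 'b::real_normed_vector"
  assumes "compact K"
    and cont: "\<And>j. continuous_on K (G j)"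
    and zeros: "\<And>z. z \<in> K \<Longrightarrow> (\<And>j. G j z = 0) \<Longrightarrow> z \<in> Y"
    and Y: "\<And>j w. w \<in> Y \<Longrightarrow> G j w = 0"
    and deriv: "\<And>j w. w \<in> Y \<Longrightarrow> (G j has_derivative D j w) (at w)"
    and inj: "\<And>w a. w \<in> Y \<Longrightarrow> (\<And>j. D j w a = 0) \<Longrightarrow> a = 0"
  shows "\<exists>N. \<forall>z\<in>K. (\<forall>j<N. G j z = 0) \<longrightarrow> z \<in> Y"
proof (rule ccontr)
  assume "\<not> ?thesis"
  then have "\<forall>n. \<exists>z. z \<in> K \<and> (\<forall>j<n. G j z = 0) \<and> z \<notin> Y" by blast
  then obtain z where z: "\<And>n. z n \<in> K" "\<And>n j. j < n \<Longrightarrow> G j (z n) = 0" "\<And>n. z n \<notin> Y"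
    by metis
  obtain w r where w: "w \<in> K" "strict_mono r" "(z \<circ> r) \<longlonglongrightarrow> w"
    using assms(1) z(1) unfolding compact_def by meson
  have ev: "eventually (\<lambda>n. G j (z (s n)) = 0) sequentially" if "strict_mono s" for j s
    using eventually_gt_at_top[of j]
    by eventually_elim (metis z(2) strict_mono_imp_increasing[OF that] order_less_le_trans)
  have "G j w = 0" for j
  proof -
    have "(\<lambda>n. G j (z (r n))) \<longlonglongrightarrow> G j w"
      using continuous_on_tendsto_compose[OF cont w(3) w(1)] z(1) by simp
    moreover have "(\<lambda>n. G j (z (r n))) \<longlonglongrightarrow> 0"
      using ev[OF w(2), of j] by (simp add: tendsto_eventually)
    ultimately show ?thesis by (rule LIMSEQ_unique)
  qed
  then have wY: "w \<in> Y" using zeros w(1) by blast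
  have ne: "z n \<noteq> w" for n using z(3) wY by metis
  have "sgn (z (r n) - w) \<in> sphere 0 1" for n
    using ne by (simp add: norm_sgn)
  then obtain a q where a: "a \<in> sphere 0 1" "strict_mono q" "((\<lambda>n. sgn (z (r n) - w)) \<circ> q) \<longlonglongrightarrow> a"
    using compact_sphere[of "0::'a" 1] unfolding compact_def by meson
  have "D j w a = 0" for j
  proof (rule directional_derivative_zero_of_zeros_accumulating[OF deriv[OF wY]])
    show "(\<lambda>n. z (r (q n))) \<longlonglongrightarrow> w"
      using LIMSEQ_subseq_LIMSEQ[OF w(3) a(2)] by (simp add: o_def)
    show "(\<lambda>n. sgn (z (r (q n)) - w)) \<longlonglongrightarrow> a" using a(3) by (simp add: o_def)
    show "\<forall>\<^sub>F n in sequentially. G j (z (r (q n))) = G j w"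
      using ev[of "r \<circ> q" j] w(2) a(2) Y[OF wY, of j] by (simp add: strict_mono_o)
  qed (use ne in auto)
  with inj wY have "a = 0" by blast
  with a(1) show False by simp
qed

section \<open>Real-analyticity of plane waves\<close>

text \<open>The product rule for infinite sums computes the value but leaves summability open.
  Summability comes from the default value \<open>0\<close> of a divergent sum: the product
  of the norm series, each increased by \<open>1\<close> to make it positive, has a nonzero sum and
  therefore converges, and it dominates the family.\<close>

lemma has_sum_prod_family:
  fixes f :: "'n::finite \<Rightarrow> nat \<Rightarrow> complex"
  assumes "\<And>i. (f i has_sum s i) UNIV"
  shows "((\<lambda>\<nu>. \<Prod>i\<in>UNIV. f i (\<nu> i)) has_sum (\<Prod>i\<in>UNIV. s i)) UNIV"
proof -
  have abs: "(\<lambda>n. norm (f i n)) summable_on UNIV" for i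
    using assms[of i] summable_on_iff_abs_summable_on_complex has_sum_imp_summable by blast
  define h where "h i n = norm (f i n) + (if n = 0 then 1 else 0 :: real)" for i n
  have delta: "((\<lambda>n::nat. if n = 0 then 1 else 0 :: real) has_sum 1) UNIV"
    by (rule has_sum_finite_neutralI[of "{0}"]) auto
  have h: "(h i has_sum (infsum (\<lambda>n. norm (f i n)) UNIV + 1)) UNIV" for i
    unfolding h_def by (intro has_sum_add delta has_sum_infsum abs)
  have h0: "h i n \<ge> 0" for i n by (simp add: h_def)
  have "infsum (\<lambda>\<nu>. \<Prod>i\<in>UNIV. h i (\<nu> i)) (PiE UNIV (\<lambda>_. UNIV)) = (\<Prod>i\<in>UNIV. infsum (h i) UNIV)"
    using has_sum_imp_summable[OF h] h0 by (intro infsum_prod_PiE_abs) simp_all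
  moreover have "infsum (h i) UNIV > 0" for i
    using infsumI[OF h[of i]] infsum_nonneg[of UNIV "\<lambda>n. norm (f i n)"] by simp
  ultimately have "infsum (\<lambda>\<nu>. \<Prod>i\<in>UNIV. h i (\<nu> i)) UNIV \<noteq> 0"
    by (simp add: less_imp_neq[symmetric])
  then have hs: "(\<lambda>\<nu>. \<Prod>i\<in>UNIV. h i (\<nu> i)) summable_on UNIV"
    using infsum_not_exists by blast
  have "(\<lambda>\<nu>. norm (\<Prod>i\<in>UNIV. f i (\<nu> i))) summable_on UNIV"
    by (rule summable_on_comparison_test[OF hs])
       (auto simp: prod_norm[symmetric] h_def intro!: prod_mono prod_nonneg)
  then have "(\<lambda>\<nu>. \<Prod>i\<in>UNIV. f i (\<nu> i)) summable_on UNIV"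
    by (rule abs_summable_summable)
  moreover have "infsum (\<lambda>\<nu>. \<Prod>i\<in>UNIV. f i (\<nu> i)) (PiE UNIV (\<lambda>_. UNIV)) = (\<Prod>i\<in>UNIV. infsum (f i) UNIV)"
    using abs by (intro infsum_prod_PiE_abs) simp_all
  ultimately show ?thesis
    using infsumI[OF assms] by (simp add: has_sum_iff)
qed

lemma real_analytic_at_prod_power_series:
  fixes p :: "real ^ 'n"
  assumes "\<And>i t. ((\<lambda>n. a i n * of_real (t ^ n)) has_sum h i (p $ i + t)) UNIV"
  shows "real_analytic_at (\<lambda>x. \<Prod>i\<in>UNIV. h i (x $ i)) p"
  unfolding real_analytic_at_def
proof (intro exI[of _ "\<lambda>\<nu>. \<Prod>i\<in>UNIV. a i (\<nu> i)"] exI[of _ 1] conjI ballI)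
  fix x :: "real ^ 'n"
  have "((\<lambda>\<nu>. \<Prod>i\<in>UNIV. a i (\<nu> i) * of_real ((x $ i - p $ i) ^ \<nu> i)) has_sum (\<Prod>i\<in>UNIV. h i (x $ i))) UNIV"
    using assms[of _ "x $ i - p $ i" for i] by (intro has_sum_prod_family) (metis add_diff_cancel_left' diff_add_cancel add.commute)
  then show "((\<lambda>\<nu>. (\<Prod>i\<in>UNIV. a i (\<nu> i)) * of_real (\<Prod>i\<in>UNIV. (x $ i - p $ i) ^ \<nu> i)) has_sum (\<Prod>i\<in>UNIV. h i (x $ i))) UNIV"
    by (simp add: prod.distrib)
qed simp

lemma real_analytic_at_cmult:
  assumes "real_analytic_at f p"
  shows "real_analytic_at (\<lambda>x. b * f x) p"
proof -
  obtain c r where r: "r > 0" and c: "\<And>x. x \<in> ball p r \<Longrightarrow>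
      ((\<lambda>\<nu>. c \<nu> * of_real (\<Prod>i\<in>UNIV. (x $ i - p $ i) ^ \<nu> i)) has_sum f x) UNIV"
    using assms unfolding real_analytic_at_def by blast
  have "((\<lambda>\<nu>. (b * c \<nu>) * of_real (\<Prod>i\<in>UNIV. (x $ i - p $ i) ^ \<nu> i)) has_sum (b * f x)) UNIV"
    if "x \<in> ball p r" for x
    using has_sum_cmult_right[OF c[OF that], of b] by (simp add: mult.assoc)
  then show ?thesis unfolding real_analytic_at_def using r by (intro exI[of _ "\<lambda>\<nu>. b * c \<nu>"]) blast
qed

lemma real_analytic_at_add:
  assumes "real_analytic_at f p" "real_analytic_at g p"
  shows "real_analytic_at (\<lambda>x. f x + g x) p"
proof -
  obtain c r where r: "r > 0" and c: "\<And>x. x \<in> ball p r \<Longrightarrow>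
      ((\<lambda>\<nu>. c \<nu> * of_real (\<Prod>i\<in>UNIV. (x $ i - p $ i) ^ \<nu> i)) has_sum f x) UNIV"
    using assms(1) unfolding real_analytic_at_def by blast
  obtain d s where s: "s > 0" and d: "\<And>x. x \<in> ball p s \<Longrightarrow>
      ((\<lambda>\<nu>. d \<nu> * of_real (\<Prod>i\<in>UNIV. (x $ i - p $ i) ^ \<nu> i)) has_sum g x) UNIV"
    using assms(2) unfolding real_analytic_at_def by blast
  have "((\<lambda>\<nu>. (c \<nu> + d \<nu>) * of_real (\<Prod>i\<in>UNIV. (x $ i - p $ i) ^ \<nu> i)) has_sum (f x + g x)) UNIV"
    if "x \<in> ball p (min r s)" for x
    using has_sum_add[OF c d] that by (simp add: distrib_right)
  then show ?thesis unfolding real_analytic_at_def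
    using r s by (intro exI[of _ "\<lambda>\<nu>. c \<nu> + d \<nu>"] exI[of _ "min r s"]) auto
qed

lemma real_analytic_at_sum:
  assumes "\<And>i. i \<in> I \<Longrightarrow> real_analytic_at (f i) p"
  shows "real_analytic_at (\<lambda>x. \<Sum>i\<in>I. f i x) p"
  using assms
proof (induction I rule: infinite_finite_induct)
  case (insert i I)
  then show ?case by (simp add: real_analytic_at_add)
qed (auto simp: real_analytic_at_def intro!: exI[of _ "\<lambda>_. 0"] exI[of _ 1])

text \<open>The only one-variable factors that occur below: the exponential in most coordinates and
  \<open>t * exp (c * t)\<close> in one of them. The truncated subtraction \<open>n - 1\<close> is harmless because
  the factor \<open>n\<close> kills the coefficient at \<open>0\<close>.\<close>

lemma affine_times_exp_power_series:
  fixes c q r :: complex and p t :: real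
  shows "((\<lambda>n. exp (c * of_real p) * ((q + r * of_real p) * c ^ n + r * of_nat n * c ^ (n - 1)) / fact n
            * of_real (t ^ n)) has_sum
          ((q + r * of_real (p + t)) * exp (c * of_real (p + t)))) UNIV"
proof -
  let ?e = "exp (c * of_real p)"
  have "((\<lambda>n. (c * of_real t) ^ n /\<^sub>R fact n) has_sum exp (c * of_real t)) UNIV"
    using exp_converges[of "c * of_real t"] summable_norm_exp[of "c * of_real t"]
    by (intro norm_summable_imp_has_sum) auto
  then have A: "((\<lambda>n. (c * of_real t) ^ n / fact n) has_sum exp (c * of_real t)) UNIV"
    by (simp add: scaleR_conv_of_real field_simps)
  have "((\<lambda>n. of_real t * ((c * of_real t) ^ n / fact n)) has_sum (of_real t * exp (c * of_real t))) UNIV"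
    by (rule has_sum_cmult_right[OF A])
  then have "((\<lambda>n. of_nat n * c ^ (n - 1) * of_real t ^ n / fact n) has_sum (of_real t * exp (c * of_real t))) (Suc ` UNIV)"
  proof (subst has_sum_reindex)
    have "of_nat (Suc n) * c ^ (Suc n - 1) * of_real t ^ Suc n / fact (Suc n) = of_real t * ((c * of_real t) ^ n / fact n)" for n
    proof -
      have "of_nat (Suc n) * c ^ n * of_real t ^ Suc n / (of_nat (Suc n) * fact n) = c ^ n * of_real t ^ Suc n / fact n"
        by (simp add: mult.assoc of_nat_neq_0 del: of_nat_Suc power_Suc)
      then show ?thesis by (simp only: fact_Suc diff_Suc_1 of_nat_mult of_nat_fact power_mult_distrib) simp
    qed
    then show "((\<lambda>n. of_nat n * c ^ (n - 1) * of_real t ^ n / fact n) \<circ> Suc has_sum (of_real t * exp (c * of_real t))) UNIV"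
      if "((\<lambda>n. of_real t * ((c * of_real t) ^ n / fact n)) has_sum (of_real t * exp (c * of_real t))) UNIV"
      using that by (simp only: o_def)
  qed simp
  then have B: "((\<lambda>n. of_nat n * c ^ (n - 1) * of_real t ^ n / fact n) has_sum (of_real t * exp (c * of_real t))) UNIV"
  proof (rule has_sum_cong_neutral[THEN iffD1, rotated -1])
    fix n :: nat assume "n \<in> UNIV - range Suc"
    then have "n = 0" by (cases n) auto
    then show "of_nat n * c ^ (n - 1) * of_real t ^ n / fact n = 0" by simp
  qed auto
  have factor: "e * (Q * (C * T / F) + r * (N * C' * T / F)) = e * (Q * C + r * N * C') / F * T"
    for e Q C T F N C' :: complex
    by (simp add: divide_inverse distrib_left distrib_right mult_ac)
  have collect: "e * ((q + r * p) * f + r * (t * f)) = (q + r * (p + t)) * (e * f)" for e f p t :: complex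
    by (simp add: algebra_simps)
  have "((\<lambda>n. ?e * ((q + r * of_real p) * ((c * of_real t) ^ n / fact n)
                     + r * (of_nat n * c ^ (n - 1) * of_real t ^ n / fact n))) has_sum
       (?e * ((q + r * of_real p) * exp (c * of_real t) + r * (of_real t * exp (c * of_real t))))) UNIV"
    using has_sum_cmult_right[OF has_sum_add[OF has_sum_cmult_right[OF A, of "q + r * of_real p"] has_sum_cmult_right[OF B, of r]], of ?e] .
  moreover have "?e * ((q + r * of_real p) * ((c * of_real t) ^ n / fact n)
                     + r * (of_nat n * c ^ (n - 1) * of_real t ^ n / fact n)) =
      ?e * ((q + r * of_real p) * c ^ n + r * of_nat n * c ^ (n - 1)) / fact n * of_real (t ^ n)" for n
    unfolding power_mult_distrib of_real_power by (rule factor)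
  moreover have "?e * ((q + r * of_real p) * exp (c * of_real t) + r * (of_real t * exp (c * of_real t))) =
      (q + r * of_real (p + t)) * exp (c * of_real (p + t))"
    unfolding of_real_add distrib_left[of c] exp_add by (rule collect)
  ultimately show ?thesis by (simp only:)
qed

text \<open>As a function of the direction \<open>x\<close>, this is up to a constant the far-field pattern of a
  point source at \<open>z\<close>; the steering vectors collect its values at the sampled directions.\<close>

definition plane_wave :: "real \<Rightarrow> real ^ 'n \<Rightarrow> real ^ 'n \<Rightarrow> complex" where
  "plane_wave k z x = exp (- \<i> * of_real (k * (x \<bullet> z)))"

lemma real_analytic_at_affine_plane_wave:
  "real_analytic_at (\<lambda>x. (d + b * of_real (x \<bullet> a)) * plane_wave k z x) p"
proof -
  have coord: "real_analytic_at (\<lambda>x. of_real (x $ i) * plane_wave k z x) p"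
    and plain: "real_analytic_at (\<lambda>x. plane_wave k z x) p" for i
  proof -
    have wave: "plane_wave k z x = (\<Prod>j\<in>UNIV. exp (- \<i> * of_real (k * z $ j) * of_real (x $ j)))" for x
      by (simp add: plane_wave_def inner_vec_def sum_distrib_left exp_sum[symmetric] algebra_simps sum_negf)
    let ?q = "\<lambda>j. if j = i then 0 else 1 :: complex" and ?r = "\<lambda>j. if j = i then 1 else 0 :: complex"
    have "real_analytic_at (\<lambda>x. \<Prod>j\<in>UNIV. (\<lambda>t. (?q j + ?r j * of_real t) * exp (- \<i> * of_real (k * z $ j) * of_real t)) (x $ j)) p"
      by (rule real_analytic_at_prod_power_series[OF affine_times_exp_power_series])
    moreover have "(\<Prod>j\<in>UNIV. ?q j + ?r j * of_real (x $ j)) = of_real (x $ i)" for x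
    proof -
      have "(\<Prod>j\<in>UNIV. ?q j + ?r j * of_real (x $ j)) = (\<Prod>j\<in>UNIV. if j = i then of_real (x $ j) else 1)"
        by (intro prod.cong) auto
      then show ?thesis by simp
    qed
    ultimately show "real_analytic_at (\<lambda>x. of_real (x $ i) * plane_wave k z x) p"
      by (simp add: wave prod.distrib)
    have "real_analytic_at (\<lambda>x. \<Prod>j\<in>UNIV. (\<lambda>t. (1 + 0 * of_real t) * exp (- \<i> * of_real (k * z $ j) * of_real t)) (x $ j)) p"
      by (rule real_analytic_at_prod_power_series[OF affine_times_exp_power_series])
    then show "real_analytic_at (\<lambda>x. plane_wave k z x) p"
      by (simp add: wave)
  qed
  have "(\<lambda>x. (d + b * of_real (x \<bullet> a)) * plane_wave k z x) =
      (\<lambda>x. d * plane_wave k z x + (\<Sum>i\<in>UNIV. (b * of_real (a $ i)) * (of_real (x $ i) * plane_wave k z x)))"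
    by (auto simp: fun_eq_iff inner_vec_def algebra_simps sum_distrib_left sum_distrib_right)
  then show ?thesis
    by (simp only:) (intro real_analytic_at_add real_analytic_at_sum real_analytic_at_cmult coord plain)
qed

section \<open>Linear independence of plane waves\<close>

lemma exists_unit_vector_off_hyperplanes:
  fixes E :: "'a::euclidean_space set"
  assumes "finite E" "0 \<notin> E"
  obtains u where "norm u = 1" "\<And>e. e \<in> E \<Longrightarrow> u \<bullet> e \<noteq> 0"
proof -
  obtain b :: 'a where b: "b \<in> Basis" using nonempty_Basis by blast
  let ?E = "insert b E"
  have "negligible (\<Union>e\<in>?E. {x. e \<bullet> x = 0})"
    using assms b by (intro negligible_Union) (auto intro!: negligible_hyperplane)
  then have "(\<Union>e\<in>?E. {x. e \<bullet> x = 0}) \<noteq> UNIV"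
    by (metis non_negligible_UNIV)
  then obtain x where x: "\<And>e. e \<in> ?E \<Longrightarrow> e \<bullet> x \<noteq> 0" by blast
  then have "x \<noteq> 0" by force
  show thesis
  proof (rule that[of "sgn x"])
    show "norm (sgn x) = 1" using \<open>x \<noteq> 0\<close> by (simp add: norm_sgn)
    show "sgn x \<bullet> e \<noteq> 0" if "e \<in> E" for e
      using x[of e] that \<open>x \<noteq> 0\<close> by (simp add: sgn_div_norm inner_commute)
  qed
qed

text \<open>On a great circle \<open>x = cos t u + sin t v\<close> the vanishing sum is the restriction of an
  entire function of \<open>t\<close>, so it vanishes for complex \<open>t\<close> too. Along
  \<open>t = pi / 2 + \<i> * arsinh X\<close> the terms have modulus \<open>exp (- k * (u \<bullet> y m) * X)\<close> up to a factor of
  at most linear growth. If \<open>u\<close> is chosen off finitely many hyperplanes, these exponential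
  rates are distinct, and as \<open>X\<close> tends to infinity the dominant term must have coefficient zero.
  The choice also gives \<open>u \<bullet> a \<noteq> 0\<close>, which separates the two parts of that coefficient. The factors affine in \<open>x\<close> are included because they arise as derivatives of
  \<open>plane_wave k z x\<close> with respect to \<open>z\<close>.\<close>

lemma affine_plane_waves_independent_on_sphere:
  fixes y :: "'i \<Rightarrow> real ^ 3"
  assumes I: "finite I" "inj_on y I" and k: "k > 0" and a: "a \<noteq> 0"
    and vanish: "\<And>x. norm x = 1 \<Longrightarrow> (\<Sum>m\<in>I. (d m + b m * of_real (x \<bullet> a)) * plane_wave k (y m) x) = 0"
  shows "\<forall>m\<in>I. d m = 0 \<and> b m = 0"
proof (rule ccontr)
  assume neg: "\<not> ?thesis"
  define S where "S = {m\<in>I. d m \<noteq> 0 \<or> b m \<noteq> 0}"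
  have S: "finite S" "S \<subseteq> I" "S \<noteq> {}" using neg I by (auto simp: S_def)
  define E where "E = insert a ((\<lambda>(m, m'). y m - y m') ` {(m, m'). m \<in> S \<and> m' \<in> S \<and> m \<noteq> m'})"
  have "finite E"
  proof -
    have "finite {(m, m'). m \<in> S \<and> m' \<in> S \<and> m \<noteq> m'}"
      by (rule finite_subset[of _ "S \<times> S"]) (use S in auto)
    then show ?thesis by (simp add: E_def)
  qed
  moreover have "0 \<notin> E"
    unfolding E_def using a inj_onD[OF I(2)] S(2) by (auto simp: subset_iff)
  ultimately obtain u where u: "norm u = 1" and uE: "\<And>e. e \<in> E \<Longrightarrow> u \<bullet> e \<noteq> 0"
    by (rule exists_unit_vector_off_hyperplanes) blast
  have ua: "u \<bullet> a \<noteq> 0" using uE by (simp add: E_def)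
  obtain v0 where v0: "v0 \<noteq> 0" "u \<bullet> v0 = 0"
    using orthogonal_to_vector_exists[of u] by (auto simp: Linear_Algebra.orthogonal_def)
  define v where "v = sgn v0"
  have v: "norm v = 1" "u \<bullet> v = 0"
    using v0 by (auto simp: v_def norm_sgn sgn_div_norm)
  define \<theta> where "\<theta> \<zeta> w = cos \<zeta> * of_real (u \<bullet> w) + sin \<zeta> * of_real (v \<bullet> w)" for \<zeta> :: complex and w
  define h where "h \<zeta> = (\<Sum>m\<in>S. (d m + b m * \<theta> \<zeta> a) * exp (- \<i> * of_real k * \<theta> \<zeta> (y m)))" for \<zeta>
  have h_real: "h (of_real t) = 0" for t
  proof -
    let ?x = "cos t *\<^sub>R u + sin t *\<^sub>R v"
    have "(norm ?x)\<^sup>2 = 1"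
      unfolding power2_norm_eq_inner using u v
      by (simp add: inner_add_left inner_add_right inner_commute norm_eq_1 power2_eq_square[symmetric])
    then have nx: "norm ?x = 1" using power2_eq_imp_eq[of "norm ?x" 1] by simp
    have "\<theta> (of_real t) w = of_real (?x \<bullet> w)" for w
      by (simp add: \<theta>_def inner_add_left cos_of_real sin_of_real)
    then have "h (of_real t) = (\<Sum>m\<in>S. (d m + b m * of_real (?x \<bullet> a)) * plane_wave k (y m) ?x)"
      by (simp add: h_def plane_wave_def mult.assoc)
    also have "\<dots> = (\<Sum>m\<in>I. (d m + b m * of_real (?x \<bullet> a)) * plane_wave k (y m) ?x)"
      using I(1) by (intro sum.mono_neutral_left) (auto simp: S_def)
    finally show ?thesis using vanish[OF nx] by simp
  qed
  have h_zero: "h \<zeta> = 0" for \<zeta>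
  proof (rule analytic_continuation[of h UNIV "range of_real" 0])
    show "h holomorphic_on UNIV"
      unfolding h_def \<theta>_def by (intro holomorphic_intros)
    show "(0::complex) islimpt range of_real"
      unfolding islimpt_approachable
    proof (intro allI impI)
      fix e :: real assume "e > 0"
      then show "\<exists>x'\<in>range complex_of_real. x' \<noteq> 0 \<and> dist x' 0 < e"
        by (intro bexI[OF _ rangeI[of _ "e / 2"]]) auto
    qed
  qed (use h_real in auto)
  \<comment> \<open>The smallest \<open>u \<bullet> y m\<close> belongs to the dominant term.\<close>
  obtain m0 where m0: "m0 \<in> S" "\<And>m. m \<in> S \<Longrightarrow> u \<bullet> y m0 \<le> u \<bullet> y m"
    using ex_is_arg_min_if_finite[OF S(1,3), of "\<lambda>m. u \<bullet> y m"] by (auto simp: is_arg_min_linorder)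
  have gap: "u \<bullet> y m - u \<bullet> y m0 > 0" if "m \<in> S - {m0}" for m
  proof -
    have "y m - y m0 \<in> E" unfolding E_def using that m0(1) by (intro insertI2 image_eqI[of _ _ "(m, m0)"]) auto
    from uE[OF this] m0(2)[of m] that show ?thesis by (auto simp: inner_diff_right)
  qed
  \<comment> \<open>\<open>\<tau> X w\<close> is the value of \<open>x \<bullet> w\<close> at the complex parameter \<open>pi / 2 + \<i> * arsinh X\<close>,
    where the cosine is \<open>- \<i> * X\<close> and the sine is \<open>sqrt (X\<^sup>2 + 1)\<close>.\<close>
  define \<tau> where "\<tau> X w = Complex (sqrt (X\<^sup>2 + 1) * (v \<bullet> w)) (- X * (u \<bullet> w))" for X w
  have \<theta>_cx: "\<theta> (of_real (pi / 2) + \<i> * of_real (arsinh X)) w = \<tau> X w" for X w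
  proof -
    have "cos (\<i> * of_real (arsinh X)) = of_real (cosh (arsinh X))"
      by (simp add: cos_i_times cosh_field_def exp_of_real[symmetric] exp_minus del: cosh_arsinh_real)
    moreover have "sin (\<i> * of_real (arsinh X)) = \<i> * of_real (sinh (arsinh X))"
      by (simp add: sin_i_times sinh_field_def exp_of_real[symmetric] exp_minus del: sinh_arsinh_real)
    ultimately have c: "cos (of_real (pi / 2) + \<i> * of_real (arsinh X)) = - \<i> * of_real X"
      and s: "sin (of_real (pi / 2) + \<i> * of_real (arsinh X)) = of_real (sqrt (X\<^sup>2 + 1))"
      by (simp_all add: cos_add sin_add cosh_arsinh_real)
    show ?thesis unfolding \<theta>_def c s by (simp add: \<tau>_def complex_eq_iff)
  qed
  have \<tau>0: "(\<Sum>m\<in>S. (d m + b m * \<tau> X a) * exp (- \<i> * of_real k * \<tau> X (y m))) = 0" for X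
    using h_zero[of "of_real (pi / 2) + \<i> * of_real (arsinh X)"] by (simp only: h_def \<theta>_cx)
  have bound: "norm (d m0 + b m0 * \<tau> X a) \<le>
      (\<Sum>m\<in>S - {m0}. (norm (d m) + norm (b m) * (sqrt (X\<^sup>2 + 1) * \<bar>v \<bullet> a\<bar> + X * \<bar>u \<bullet> a\<bar>))
          * exp (- (k * (u \<bullet> y m - u \<bullet> y m0)) * X))" (is "_ \<le> ?R X") if "X \<ge> 0" for X
  proof -
    let ?e = "\<lambda>m. exp (- \<i> * of_real k * \<tau> X (y m))"
    have ne: "norm (?e m) = exp (- (k * (u \<bullet> y m)) * X)" for m
      by (simp add: \<tau>_def)
    have eq: "(d m0 + b m0 * \<tau> X a) * ?e m0 = - (\<Sum>m\<in>S - {m0}. (d m + b m * \<tau> X a) * ?e m)"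
      using \<tau>0[of X] sum.remove[OF S(1) m0(1), of "\<lambda>m. (d m + b m * \<tau> X a) * ?e m"]
      by (simp add: eq_neg_iff_add_eq_0)
    have "norm (d m0 + b m0 * \<tau> X a) * norm (?e m0) = norm (\<Sum>m\<in>S - {m0}. (d m + b m * \<tau> X a) * ?e m)"
      unfolding norm_mult[symmetric] eq by (rule norm_minus_cancel)
    also have "\<dots> \<le> (\<Sum>m\<in>S - {m0}. norm ((d m + b m * \<tau> X a) * ?e m))"
      by (rule norm_sum)
    also have "\<dots> \<le> (\<Sum>m\<in>S - {m0}. (norm (d m) + norm (b m) * (sqrt (X\<^sup>2 + 1) * \<bar>v \<bullet> a\<bar> + X * \<bar>u \<bullet> a\<bar>)) * norm (?e m))"
    proof (rule sum_mono)
      fix m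
      have "norm (\<tau> X a) \<le> sqrt (X\<^sup>2 + 1) * \<bar>v \<bullet> a\<bar> + X * \<bar>u \<bullet> a\<bar>"
        using cmod_le[of "\<tau> X a"] that by (simp add: \<tau>_def abs_mult)
      then have "norm (b m * \<tau> X a) \<le> norm (b m) * (sqrt (X\<^sup>2 + 1) * \<bar>v \<bullet> a\<bar> + X * \<bar>u \<bullet> a\<bar>)"
        unfolding norm_mult by (rule mult_left_mono) simp
      then have "norm (d m + b m * \<tau> X a) \<le> norm (d m) + norm (b m) * (sqrt (X\<^sup>2 + 1) * \<bar>v \<bullet> a\<bar> + X * \<bar>u \<bullet> a\<bar>)"
        by (rule order_trans[OF norm_triangle_ineq add_left_mono])
      then show "norm ((d m + b m * \<tau> X a) * ?e m) \<le> (norm (d m) + norm (b m) * (sqrt (X\<^sup>2 + 1) * \<bar>v \<bullet> a\<bar> + X * \<bar>u \<bullet> a\<bar>)) * norm (?e m)"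
        unfolding norm_mult by (rule mult_right_mono) simp
    qed
    finally have "norm (d m0 + b m0 * \<tau> X a) \<le> (\<Sum>m\<in>S - {m0}. (norm (d m) + norm (b m) * (sqrt (X\<^sup>2 + 1) * \<bar>v \<bullet> a\<bar> + X * \<bar>u \<bullet> a\<bar>)) * norm (?e m)) / norm (?e m0)"
      by (simp add: pos_le_divide_eq)
    also have "\<dots> = ?R X"
      unfolding sum_divide_distrib ne times_divide_eq_right[symmetric] exp_diff[symmetric]
      by (intro sum.cong refl arg_cong2[of _ _ _ _ "(*)"] arg_cong[of _ _ exp]) (simp add: algebra_simps)
    finally show ?thesis .
  qed
  have R0: "(?R \<longlongrightarrow> 0) at_top"
  proof (rule tendsto_null_sum)
    fix m assume "m \<in> S - {m0}"
    then have "k * (u \<bullet> y m - u \<bullet> y m0) > 0" using gap k by simp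
    then show "((\<lambda>X. (norm (d m) + norm (b m) * (sqrt (X\<^sup>2 + 1) * \<bar>v \<bullet> a\<bar> + X * \<bar>u \<bullet> a\<bar>))
          * exp (- (k * (u \<bullet> y m - u \<bullet> y m0)) * X)) \<longlongrightarrow> 0) at_top"
    proof -
      have "((\<lambda>X. (D + B * (sqrt (X\<^sup>2 + 1) * V + X * U)) * exp (- g * X)) \<longlongrightarrow> 0) at_top" if "g > 0" for D B U V g :: real
      proof -
        have "((\<lambda>X::real. exp (- g * X)) \<longlongrightarrow> 0) at_top" using that by real_asymp
        moreover have "((\<lambda>X::real. sqrt (X\<^sup>2 + 1) * exp (- g * X)) \<longlongrightarrow> 0) at_top" using that by real_asymp
        moreover have "((\<lambda>X::real. X * exp (- g * X)) \<longlongrightarrow> 0) at_top" using that by real_asymp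
        ultimately have "((\<lambda>X. D * exp (- g * X) + B * V * (sqrt (X\<^sup>2 + 1) * exp (- g * X)) + B * U * (X * exp (- g * X))) \<longlongrightarrow> D * 0 + B * V * 0 + B * U * 0) at_top"
          by (intro tendsto_intros)
        then show ?thesis by (simp add: algebra_simps)
      qed
      from this[OF \<open>k * (u \<bullet> y m - u \<bullet> y m0) > 0\<close>] show ?thesis by blast
    qed
  qed
  have lim: "((\<lambda>X. d m0 + b m0 * \<tau> X a) \<longlongrightarrow> 0) at_top"
    by (rule Lim_null_comparison[OF eventually_mono[OF eventually_ge_at_top[of 0] bound] R0])
  \<comment> \<open>Dividing the limit by \<open>X\<close> isolates the part of linear growth.\<close>
  have "((\<lambda>X. (d m0 + b m0 * \<tau> X a) * of_real (inverse X)) \<longlongrightarrow> 0 * of_real 0) at_top"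
    by (intro tendsto_mult lim tendsto_of_real tendsto_inverse_0_at_top filterlim_ident)
  moreover have "((\<lambda>X. (d m0 + b m0 * \<tau> X a) * of_real (inverse X)) \<longlongrightarrow>
      d m0 * of_real 0 + b m0 * (of_real (v \<bullet> a) - \<i> * of_real (u \<bullet> a))) at_top"
  proof -
    have "((\<lambda>X::real. sqrt (X\<^sup>2 + 1) / X) \<longlongrightarrow> 1) at_top" by real_asymp
    then have "((\<lambda>X. d m0 * of_real (inverse X) + b m0 * (of_real (sqrt (X\<^sup>2 + 1) / X * (v \<bullet> a)) - \<i> * of_real (u \<bullet> a))) \<longlongrightarrow>
      d m0 * of_real 0 + b m0 * (of_real (1 * (v \<bullet> a)) - \<i> * of_real (u \<bullet> a))) at_top"
      by (intro tendsto_intros tendsto_inverse_0_at_top filterlim_ident)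
    moreover have "eventually (\<lambda>X. d m0 * of_real (inverse X) + b m0 * (of_real (sqrt (X\<^sup>2 + 1) / X * (v \<bullet> a)) - \<i> * of_real (u \<bullet> a))
        = (d m0 + b m0 * \<tau> X a) * of_real (inverse X)) at_top"
      using eventually_gt_at_top[of 0]
      by eventually_elim (simp add: \<tau>_def Complex_eq field_simps)
    ultimately show ?thesis unfolding mult_1_left by (rule Lim_transform_eventually)
  qed
  ultimately have "0 * of_real 0 = d m0 * of_real 0 + b m0 * (of_real (v \<bullet> a) - \<i> * of_real (u \<bullet> a))"
    by (rule tendsto_unique[OF trivial_limit_at_top_linorder])
  then have "b m0 * (of_real (v \<bullet> a) - \<i> * of_real (u \<bullet> a)) = 0" by simp
  moreover have "of_real (v \<bullet> a) - \<i> * of_real (u \<bullet> a) \<noteq> (0::complex)"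
    using ua by (simp add: complex_eq_iff)
  ultimately have b0: "b m0 = 0" by auto
  with lim have "d m0 = 0"
    by (simp add: tendsto_const_iff)
  with b0 m0(1) show False by (simp add: S_def)
qed

lemma affine_plane_waves_independent_on_determining_set:
  fixes y :: "'i \<Rightarrow> real ^ 3" and \<theta> :: "nat \<Rightarrow> real ^ 3"
  assumes I: "finite I" "inj_on y I" and k: "k > 0" and a: "a \<noteq> 0"
    and determining: "\<And>f :: real ^ 3 \<Rightarrow> complex.
           real_analytic_on f (sphere 0 1) \<Longrightarrow> (\<And>n. f (\<theta> n) = 0) \<Longrightarrow> (\<forall>x\<in>sphere 0 1. f x = 0)"
    and vanish: "\<And>n. (\<Sum>m\<in>I. (d m + b m * of_real (\<theta> n \<bullet> a)) * plane_wave k (y m) (\<theta> n)) = 0"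
  shows "\<forall>m\<in>I. d m = 0 \<and> b m = 0"
proof (rule affine_plane_waves_independent_on_sphere[OF I k a])
  let ?f = "\<lambda>x. \<Sum>m\<in>I. (d m + b m * of_real (x \<bullet> a)) * plane_wave k (y m) x"
  have an: "real_analytic_at ?f q" for q
    by (intro real_analytic_at_sum real_analytic_at_affine_plane_wave)
  have "real_analytic_on ?f (sphere 0 1)"
    unfolding real_analytic_on_def by (intro ballI exI[of _ UNIV] exI[of _ ?f]) (use an in auto)
  from determining[OF this vanish] show "?f x = 0" if "norm x = 1" for x
    using that by simp
qed

lemma plane_wave_derivative:
  "((\<lambda>z. plane_wave k z x) has_derivative (\<lambda>a. (- \<i> * of_real k) * of_real (x \<bullet> a) * plane_wave k w x)) (at w)"
proof -
  have "((\<lambda>z. - \<i> * of_real (k * (x \<bullet> z))) has_derivative (\<lambda>a. - \<i> * of_real (k * (x \<bullet> a)))) (at w)"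
    by (auto intro!: derivative_eq_intros)
  from has_derivative_compose[OF this, of exp "\<lambda>h. exp (- \<i> * of_real (k * (x \<bullet> w))) * h"]
  have "((\<lambda>z. exp (- \<i> * of_real (k * (x \<bullet> z)))) has_derivative
      (\<lambda>a. exp (- \<i> * of_real (k * (x \<bullet> w))) * (- \<i> * of_real (k * (x \<bullet> a))))) (at w)"
    using DERIV_exp[of "- \<i> * of_real (k * (x \<bullet> w))"] by (simp add: has_field_derivative_def)
  then show ?thesis
    by (simp add: plane_wave_def algebra_simps)
qed

section \<open>Orthogonal projections and ranges of complex matrices\<close>

definition adjoint_mat :: "complex mat \<Rightarrow> complex mat" where
  "adjoint_mat A = mat (dim_col A) (dim_row A) (\<lambda>(i, j). cnj (A $$ (j, i)))"

lemma adjoint_mat_carrier: "A \<in> carrier_mat n m \<Longrightarrow> adjoint_mat A \<in> carrier_mat m n"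
  by (auto simp: adjoint_mat_def)

lemma adjoint_mat_inner:
  assumes A: "A \<in> carrier_mat n m" and x: "x \<in> carrier_vec n" and c: "c \<in> carrier_vec m"
  shows "x \<bullet>c (A *\<^sub>v c) = (adjoint_mat A *\<^sub>v x) \<bullet>c c"
proof -
  have "x \<bullet>c (A *\<^sub>v c) = (\<Sum>i<n. vec_index x i * cnj (\<Sum>j<m. A $$ (i, j) * vec_index c j))"
    using assms by (auto simp: scalar_prod_def lessThan_atLeast0 intro!: sum.cong)
  also have "\<dots> = (\<Sum>j<m. (\<Sum>i<n. cnj (A $$ (i, j)) * vec_index x i) * cnj (vec_index c j))"
    by (simp add: sum_distrib_left sum_distrib_right mult_ac) (rule sum.swap)
  also have "\<dots> = (adjoint_mat A *\<^sub>v x) \<bullet>c c"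
    using assms by (auto simp: scalar_prod_def lessThan_atLeast0 adjoint_mat_def intro!: sum.cong)
  finally show ?thesis .
qed

definition full_column_rank :: "complex mat \<Rightarrow> bool" where
  "full_column_rank A \<longleftrightarrow>
     (\<forall>c\<in>carrier_vec (dim_col A). A *\<^sub>v c = 0\<^sub>v (dim_row A) \<longrightarrow> c = 0\<^sub>v (dim_col A))"

text \<open>The kernel of \<open>A\<^sup>* A\<close> is the kernel of \<open>A\<close>, because \<open>A\<^sup>* A c = 0\<close> gives
  \<open>\<bar>A c\<bar>\<^sup>2 = 0\<close>.\<close>

lemma gram_inverse:
  assumes A: "A \<in> carrier_mat n m" and rk: "full_column_rank A"
  obtains G where "G \<in> carrier_mat m m"
    "\<And>c. c \<in> carrier_vec m \<Longrightarrow> adjoint_mat A *\<^sub>v (A *\<^sub>v (G *\<^sub>v c)) = c"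
proof -
  let ?H = "adjoint_mat A"
  have H: "?H \<in> carrier_mat m n" using A by (rule adjoint_mat_carrier)
  have HA: "?H * A \<in> carrier_mat m m" by (rule mult_carrier_mat[OF H A])
  have "det (?H * A) \<noteq> 0"
  proof
    assume "det (?H * A) = 0"
    then obtain c where c: "c \<in> carrier_vec m" "c \<noteq> 0\<^sub>v m" "(?H * A) *\<^sub>v c = 0\<^sub>v m"
      using det_0_iff_vec_prod_zero_field[OF HA] by blast
    then have "?H *\<^sub>v (A *\<^sub>v c) = 0\<^sub>v m" using assoc_mult_mat_vec[OF H A] by simp
    then have "(A *\<^sub>v c) \<bullet>c (A *\<^sub>v c) = 0"
      using adjoint_mat_inner[OF A _ c(1), of "A *\<^sub>v c"] A c(1) by simp
    then have "A *\<^sub>v c = 0\<^sub>v n" using A c(1) by (subst (asm) conjugate_square_eq_0_vec[of _ n]) auto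
    with rk c A show False by (auto simp: full_column_rank_def)
  qed
  from det_non_zero_imp_unit[OF HA this] obtain G where G: "G \<in> carrier_mat m m" "?H * A * G = 1\<^sub>m m"
    by (auto simp: Units_def ring_mat_def)
  show thesis
  proof (rule that[OF G(1)])
    fix c :: "complex Matrix.vec" assume c: "c \<in> carrier_vec m"
    then have "?H *\<^sub>v (A *\<^sub>v (G *\<^sub>v c)) = (?H * A * G) *\<^sub>v c"
      using assoc_mult_mat_vec[OF HA G(1) c] assoc_mult_mat_vec[OF H A, of "G *\<^sub>v c"] G(1) by simp
    then show "?H *\<^sub>v (A *\<^sub>v (G *\<^sub>v c)) = c" using G c by simp
  qed
qed

lemma orth_compl_minus:
  assumes "p \<in> orth_compl n W" "q \<in> orth_compl n W" "W \<subseteq> carrier_vec n"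
  shows "p - q \<in> orth_compl n W"
  using assms by (auto simp: orth_compl_def minus_scalar_prod_distrib[of _ n] subset_iff)

lemma orth_compl_disjoint:
  assumes "p \<in> W" "p \<in> orth_compl n W"
  shows "p = 0\<^sub>v n"
  using assms conjugate_square_eq_0_vec[of p n] by (auto simp: orth_compl_def)

lemma subset_orth_compl_orth_compl:
  assumes "W \<subseteq> carrier_vec n"
  shows "W \<subseteq> orth_compl n (orth_compl n W)"
proof
  fix w assume w: "w \<in> W"
  have "w \<bullet>c v = 0" if v: "v \<in> orth_compl n W" for v
  proof -
    have "v \<bullet>c w = 0" "v \<in> carrier_vec n" "w \<in> carrier_vec n"
      using v w assms by (auto simp: orth_compl_def)
    then show ?thesis
      using conjugate_vec_sprod_comm[of v n w] conjugate_conjugate_sprod[of w n v] by simp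
  qed
  then show "w \<in> orth_compl n (orth_compl n W)" using w assms by (auto simp: orth_compl_def)
qed

text \<open>The projection is a definite description; two candidates differ by a vector that is in
  \<open>W\<close> and orthogonal to \<open>W\<close>.\<close>

lemma orth_proj_eqI:
  assumes W: "W \<subseteq> carrier_vec n" and p: "p \<in> W" and v: "v \<in> carrier_vec n"
    and vp: "v - p \<in> orth_compl n W"
    and sub: "\<And>p q. p \<in> W \<Longrightarrow> q \<in> W \<Longrightarrow> p - q \<in> W"
  shows "orth_proj n W v = p"
  unfolding orth_proj_def
proof (rule the_equality)
  fix q assume q: "q \<in> W \<and> v - q \<in> orth_compl n W"
  have pq: "p \<in> carrier_vec n" "q \<in> carrier_vec n" using p q W by auto
  have "(v - p) - (v - q) = q - p" using pq v by auto
  then have "q - p \<in> orth_compl n W" using orth_compl_minus[OF vp _ W, of "v - q"] q by simp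
  with sub[of q p] p q have "q - p = 0\<^sub>v n" by (auto intro: orth_compl_disjoint)
  moreover have "q = (q - p) + p" using pq by auto
  ultimately show "q = p" using pq by simp
qed (use p vp in auto)

text \<open>The normal equations \<open>A\<^sup>* A c = A\<^sup>* v\<close> have a solution \<open>c\<close>, and \<open>A c\<close> is the component
  of \<open>v\<close> in the range. Hence the residual \<open>v - A c\<close> is the projection onto the complement, and
  the double complement of the range never has to be computed.\<close>

lemma orth_proj_orth_compl_eq_0_iff:
  assumes A: "A \<in> carrier_mat n m" and rk: "full_column_rank A" and v: "v \<in> carrier_vec n"
  shows "orth_proj n (orth_compl n (mat_range A)) v = 0\<^sub>v n \<longleftrightarrow> v \<in> mat_range A"
proof -
  let ?R = "mat_range A" and ?H = "adjoint_mat A"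
  obtain G where G: "G \<in> carrier_mat m m"
    and inv: "\<And>c. c \<in> carrier_vec m \<Longrightarrow> ?H *\<^sub>v (A *\<^sub>v (G *\<^sub>v c)) = c"
    using gram_inverse[OF A rk] by blast
  have H: "?H \<in> carrier_mat m n" using A by (rule adjoint_mat_carrier)
  have R: "?R \<subseteq> carrier_vec n" using A by (auto simp: mat_range_def)
  define c where "c = G *\<^sub>v (?H *\<^sub>v v)"
  have c: "c \<in> carrier_vec m" using G H v by (simp add: c_def)
  define s where "s = v - A *\<^sub>v c"
  have Ac: "A *\<^sub>v c \<in> ?R" using c A by (auto simp: mat_range_def)
  have s: "s \<in> carrier_vec n" using v A c by (simp add: s_def)
  have "?H *\<^sub>v s = 0\<^sub>v m"
  proof -
    have Hv: "?H *\<^sub>v v \<in> carrier_vec m" using mult_mat_vec_carrier[OF H v] .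
    have "?H *\<^sub>v s = ?H *\<^sub>v v - ?H *\<^sub>v (A *\<^sub>v c)"
      unfolding s_def by (rule mult_minus_distrib_mat_vec[OF H v mult_mat_vec_carrier[OF A c]])
    also have "?H *\<^sub>v (A *\<^sub>v c) = ?H *\<^sub>v v"
      unfolding c_def by (rule inv[OF Hv])
    finally show ?thesis using Hv by simp
  qed
  then have sR: "s \<in> orth_compl n ?R"
    using s A adjoint_mat_inner[OF A s] by (auto simp: orth_compl_def mat_range_def)
  have "orth_proj n (orth_compl n ?R) v = s"
  proof (rule orth_proj_eqI)
    have "v - s = A *\<^sub>v c" using v A c by (auto simp: s_def)
    then show "v - s \<in> orth_compl n (orth_compl n ?R)"
      using Ac subset_orth_compl_orth_compl[OF R] by auto
    show "p - q \<in> orth_compl n ?R" if "p \<in> orth_compl n ?R" "q \<in> orth_compl n ?R" for p q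
      using orth_compl_minus[OF that R] .
  qed (use sR v in \<open>auto simp: orth_compl_def\<close>)
  moreover have "s = 0\<^sub>v n \<longleftrightarrow> v \<in> ?R"
  proof
    assume "s = 0\<^sub>v n"
    have "v = s + A *\<^sub>v c" using v A c by (auto simp: s_def)
    also have "\<dots> = A *\<^sub>v c" using A c by (simp add: \<open>s = 0\<^sub>v n\<close>)
    finally have "v = A *\<^sub>v c" .
    then show "v \<in> ?R" using Ac by simp
  next
    assume "v \<in> ?R"
    then obtain e where e: "e \<in> carrier_vec m" "v = A *\<^sub>v e" using A by (auto simp: mat_range_def)
    then have "s = A *\<^sub>v (e - c)" using mult_minus_distrib_mat_vec[OF A e(1) c] by (simp add: s_def)
    then have "s \<in> ?R" using A e c by (auto simp: mat_range_def)
    then show "s = 0\<^sub>v n" using sR by (rule orth_compl_disjoint)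
  qed
  ultimately show ?thesis by simp
qed

text \<open>\<open>A\<^sup>*\<close> is onto because \<open>A\<close> has full column rank: \<open>A\<^sup>*\<close> maps
  \<open>A (A\<^sup>* A)\<^bsup>-1\<^esup> c\<close> to \<open>c\<close>. As \<open>B\<close> is invertible, \<open>B A\<^sup>*\<close> is onto as well, and only
  the left factor matters for the range.\<close>

lemma mat_range_factorization:
  assumes A: "A \<in> carrier_mat n m" and rk: "full_column_rank A"
    and B: "B \<in> carrier_mat m m" and C: "C \<in> carrier_mat m m" and BC: "B * C = 1\<^sub>m m"
    and F: "F = A * (B * adjoint_mat A)"
  shows "mat_range F = mat_range A"
proof -
  let ?H = "adjoint_mat A"
  have H: "?H \<in> carrier_mat m n" using A by (rule adjoint_mat_carrier)
  have Fv: "F *\<^sub>v v = A *\<^sub>v (B *\<^sub>v (?H *\<^sub>v v))" if "v \<in> carrier_vec n" for v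
    using that assoc_mult_mat_vec[OF A mult_carrier_mat[OF B H] that] assoc_mult_mat_vec[OF B H that] by (simp add: F)
  have Fc: "F \<in> carrier_mat n n" using A B H by (simp add: F)
  obtain G where G: "G \<in> carrier_mat m m"
    and inv: "\<And>c. c \<in> carrier_vec m \<Longrightarrow> ?H *\<^sub>v (A *\<^sub>v (G *\<^sub>v c)) = c"
    using gram_inverse[OF A rk] by blast
  have AF: "A *\<^sub>v c = F *\<^sub>v (A *\<^sub>v (G *\<^sub>v (C *\<^sub>v c)))" if "c \<in> carrier_vec m" for c
    using that A G C Fv[of "A *\<^sub>v (G *\<^sub>v (C *\<^sub>v c))"] inv[of "C *\<^sub>v c"]
      assoc_mult_mat_vec[OF B C that] BC by simp
  show ?thesis
  proof (intro equalityI subsetI)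
    fix w assume "w \<in> mat_range F"
    then obtain v where v: "v \<in> carrier_vec n" "w = F *\<^sub>v v" using Fc by (auto simp: mat_range_def)
    have "B *\<^sub>v (?H *\<^sub>v v) \<in> carrier_vec (dim_col A)"
      using mult_mat_vec_carrier[OF B mult_mat_vec_carrier[OF H v(1)]] A by simp
    then show "w \<in> mat_range A" using Fv[OF v(1)] v(2) unfolding mat_range_def by blast
  next
    fix w assume "w \<in> mat_range A"
    then obtain c where c: "c \<in> carrier_vec m" "w = A *\<^sub>v c" using A by (auto simp: mat_range_def)
    have "A *\<^sub>v (G *\<^sub>v (C *\<^sub>v c)) \<in> carrier_vec (dim_col F)"
      using mult_mat_vec_carrier[OF A mult_mat_vec_carrier[OF G mult_mat_vec_carrier[OF C c(1)]]] Fc by simp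
    then show "w \<in> mat_range F" using AF[OF c(1)] c(2) unfolding mat_range_def by blast
  qed
qed

section \<open>The test function as a span condition\<close>

definition wave_mat :: "real \<Rightarrow> nat \<Rightarrow> (nat \<Rightarrow> real ^ 'n) \<Rightarrow> (nat \<Rightarrow> real ^ 'n) \<Rightarrow> nat \<Rightarrow> complex mat" where
  "wave_mat k M y \<theta> N = mat N M (\<lambda>(j, m). plane_wave k (y m) (\<theta> j))"

lemma wave_mat_carrier: "wave_mat k M y \<theta> N \<in> carrier_mat N M"
  by (simp add: wave_mat_def)

lemma wave_mat_mult_vec:
  "wave_mat k M y \<theta> N *\<^sub>v Matrix.vec M c = Matrix.vec N (\<lambda>j. \<Sum>m<M. c m * plane_wave k (y m) (\<theta> j))"
proof (rule eq_vecI)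
  fix j assume "j < dim_vec (Matrix.vec N (\<lambda>j. \<Sum>m<M. c m * plane_wave k (y m) (\<theta> j)))"
  then have j: "j < N" by simp
  then have "vec_index (wave_mat k M y \<theta> N *\<^sub>v Matrix.vec M c) j = (\<Sum>m<M. plane_wave k (y m) (\<theta> j) * c m)"
    by (simp add: wave_mat_def scalar_prod_def lessThan_atLeast0)
  with j show "vec_index (wave_mat k M y \<theta> N *\<^sub>v Matrix.vec M c) j =
      vec_index (Matrix.vec N (\<lambda>j. \<Sum>m<M. c m * plane_wave k (y m) (\<theta> j))) j"
    by (simp add: mult.commute)
qed (simp add: wave_mat_def)

lemma steering_vec_in_range_wave_mat_iff:
  "steering_vec k \<theta> N z \<in> mat_range (wave_mat k M y \<theta> N) \<longleftrightarrow>
     (\<exists>c. \<forall>j<N. plane_wave k z (\<theta> j) = (\<Sum>m<M. c m * plane_wave k (y m) (\<theta> j)))"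
proof
  assume "steering_vec k \<theta> N z \<in> mat_range (wave_mat k M y \<theta> N)"
  then obtain v where v: "v \<in> carrier_vec M" "steering_vec k \<theta> N z = wave_mat k M y \<theta> N *\<^sub>v v"
    by (auto simp: mat_range_def wave_mat_def)
  have v': "Matrix.vec M (vec_index v) = v" using v(1) by auto
  have eq: "steering_vec k \<theta> N z = Matrix.vec N (\<lambda>j. \<Sum>m<M. vec_index v m * plane_wave k (y m) (\<theta> j))"
    using wave_mat_mult_vec[of k M y \<theta> N "vec_index v"] unfolding v' v(2) .
  have "plane_wave k z (\<theta> j) = (\<Sum>m<M. vec_index v m * plane_wave k (y m) (\<theta> j))" if "j < N" for j
    using arg_cong[OF eq, of "\<lambda>v. vec_index v j"] that by (simp add: steering_vec_def plane_wave_def)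
  then show "\<exists>c. \<forall>j<N. plane_wave k z (\<theta> j) = (\<Sum>m<M. c m * plane_wave k (y m) (\<theta> j))" by blast
next
  assume "\<exists>c. \<forall>j<N. plane_wave k z (\<theta> j) = (\<Sum>m<M. c m * plane_wave k (y m) (\<theta> j))"
  then obtain c where c: "\<And>j. j < N \<Longrightarrow> plane_wave k z (\<theta> j) = (\<Sum>m<M. c m * plane_wave k (y m) (\<theta> j))"
    by blast
  have "steering_vec k \<theta> N z = wave_mat k M y \<theta> N *\<^sub>v Matrix.vec M c"
    unfolding wave_mat_mult_vec steering_vec_def using c by (intro eq_vecI) (simp_all add: plane_wave_def)
  then show "steering_vec k \<theta> N z \<in> mat_range (wave_mat k M y \<theta> N)"
    unfolding mat_range_def by (auto simp: wave_mat_def)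
qed

text \<open>The functionals \<open>l m\<close> recover the coefficients of a combination of the columns from its
  first \<open>n\<close> entries.\<close>

lemma full_column_rank_wave_mat:
  assumes dual: "\<And>m m'. m < M \<Longrightarrow> m' < M \<Longrightarrow>
      (\<Sum>j<n. l m j * plane_wave k (y m') (\<theta> j)) = (if m = m' then 1 else 0)"
    and "n \<le> N"
  shows "full_column_rank (wave_mat k M y \<theta> N)"
  unfolding full_column_rank_def
proof (intro ballI impI)
  let ?A = "wave_mat k M y \<theta> N"
  have dim: "dim_col ?A = M" "dim_row ?A = N" by (simp_all add: wave_mat_def)
  fix c assume c: "c \<in> carrier_vec (dim_col ?A)" "?A *\<^sub>v c = 0\<^sub>v (dim_row ?A)"
  have c': "Matrix.vec M (vec_index c) = c" using c(1) dim by auto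
  have eq: "Matrix.vec N (\<lambda>j. \<Sum>m<M. vec_index c m * plane_wave k (y m) (\<theta> j)) = 0\<^sub>v N"
    using wave_mat_mult_vec[of k M y \<theta> N "vec_index c"] c(2) unfolding c' dim by simp
  have z: "(\<Sum>m<M. vec_index c m * plane_wave k (y m) (\<theta> j)) = 0" if "j < n" for j
    using arg_cong[OF eq, of "\<lambda>v. vec_index v j"] that \<open>n \<le> N\<close> by simp
  have "vec_index c m = 0" if "m < M" for m
  proof -
    have "0 = (\<Sum>j<n. l m j * (\<Sum>m'<M. vec_index c m' * plane_wave k (y m') (\<theta> j)))"
      using z by simp
    also have "\<dots> = (\<Sum>m'<M. \<Sum>j<n. l m j * (vec_index c m' * plane_wave k (y m') (\<theta> j)))"
      unfolding sum_distrib_left by (rule sum.swap)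
    also have "\<dots> = (\<Sum>m'<M. vec_index c m' * (\<Sum>j<n. l m j * plane_wave k (y m') (\<theta> j)))"
      unfolding sum_distrib_left by (intro sum.cong refl) (simp add: mult_ac)
    also have "\<dots> = (\<Sum>m'<M. if m' = m then vec_index c m' else 0)"
      using dual[OF that] by (intro sum.cong) auto
    also have "\<dots> = vec_index c m" using that by simp
    finally show ?thesis by simp
  qed
  then show "c = 0\<^sub>v (dim_col ?A)" using c(1) dim by (intro eq_vecI) auto
qed

text \<open>Sending and receiving use the same directions, so the factor on the sending side is the
  adjoint of the one on the receiving side.\<close>

lemma far_field_mat_factorization:
  assumes B: "mat_inverse (foldy_mat k M y \<alpha>) = Some B" "B \<in> carrier_mat M M"
  shows "far_field_mat k M y \<alpha> \<theta> N =
     wave_mat k M y \<theta> N * ((- B) * adjoint_mat (wave_mat k M y \<theta> N))"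
    (is "_ = ?A * (_ * ?H)")
proof (rule eq_matI)
  fix j l assume "j < dim_row (?A * ((- B) * ?H))" "l < dim_col (?A * ((- B) * ?H))"
  then have jl: "j < N" "l < N" by (simp_all add: wave_mat_def adjoint_mat_def)
  have ex: "exp (\<i> * of_real (k * (y m' \<bullet> \<theta> l - \<theta> j \<bullet> y m))) =
      plane_wave k (y m) (\<theta> j) * cnj (plane_wave k (y m') (\<theta> l))" for m m'
    by (simp add: plane_wave_def exp_cnj exp_add[symmetric] inner_commute algebra_simps)
  have A: "?A $$ (j, m) = plane_wave k (y m) (\<theta> j)" "?H $$ (m, l) = cnj (plane_wave k (y m) (\<theta> l))" if "m < M" for m
    using that jl by (simp_all add: wave_mat_def adjoint_mat_def)
  have d: "dim_row ?A = N" "dim_col ?A = M" "dim_row ?H = M" "dim_col ?H = N"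
    by (simp_all add: wave_mat_def adjoint_mat_def)
  have "(?A * ((- B) * ?H)) $$ (j, l) = (\<Sum>m<M. ?A $$ (j, m) * (\<Sum>m'<M. (- B) $$ (m, m') * ?H $$ (m', l)))"
    using jl d B(2) by (simp add: scalar_prod_def lessThan_atLeast0 sum_negf)
  also have "\<dots> = far_field_mat k M y \<alpha> \<theta> N $$ (j, l)"
  proof -
    have "far_field_mat k M y \<alpha> \<theta> N $$ (j, l) =
        - (\<Sum>m<M. \<Sum>m'<M. B $$ (m, m') * (plane_wave k (y m) (\<theta> j) * cnj (plane_wave k (y m') (\<theta> l))))"
      using jl unfolding far_field_mat_def by (simp only: far_field_def B(1) option.sel ex index_mat prod.case)
    then show ?thesis
      using B(2) by (simp add: A sum_distrib_left sum_negf mult_ac)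
  qed
  finally show "far_field_mat k M y \<alpha> \<theta> N $$ (j, l) = (?A * ((- B) * ?H)) $$ (j, l)" ..
qed (simp_all add: far_field_mat_def wave_mat_def adjoint_mat_def)

lemma mat_inverse_of_invertible:
  fixes P :: "'a::field mat"
  assumes P: "P \<in> carrier_mat n n" and inv: "invertible_mat P"
  obtains B where "mat_inverse P = Some B" "B \<in> carrier_mat n n" "B * P = 1\<^sub>m n"
proof (cases "mat_inverse P")
  case None
  obtain Q where Q: "P * Q = 1\<^sub>m n" "Q * P = 1\<^sub>m (dim_row Q)"
    using inv P by (auto simp: invertible_mat_def inverts_mat_def)
  have "dim_row Q = n" "dim_col Q = n"
    using P arg_cong[OF Q(1), of dim_col] arg_cong[OF Q(2), of dim_col] by auto
  then have "P \<in> Units (ring_mat TYPE('a) n ())"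
    using P Q by (auto simp: Units_def ring_mat_def)
  with mat_inverse(1)[OF P None, of "()"] show ?thesis by blast
next
  case (Some B)
  with mat_inverse(2)[OF P Some] that show ?thesis by blast
qed

lemma test_fun_eq_infinity_iff:
  assumes inv: "invertible_mat (foldy_mat k M y \<alpha>)"
    and rk: "full_column_rank (wave_mat k M y \<theta> N)"
  shows "test_fun k M y \<alpha> \<theta> N z = \<infinity> \<longleftrightarrow>
     (\<exists>c. \<forall>j<N. plane_wave k z (\<theta> j) = (\<Sum>m<M. c m * plane_wave k (y m) (\<theta> j)))"
proof -
  let ?P = "foldy_mat k M y \<alpha>" and ?A = "wave_mat k M y \<theta> N"
  have P: "?P \<in> carrier_mat M M" by (simp add: foldy_mat_def)
  obtain B where B: "mat_inverse ?P = Some B" "B \<in> carrier_mat M M" "B * ?P = 1\<^sub>m M"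
    using mat_inverse_of_invertible[OF P inv] .
  have "(- B) * (- ?P) = 1\<^sub>m M"
    using B P by simp
  then have range: "mat_range (far_field_mat k M y \<alpha> \<theta> N) = mat_range ?A"
    using mat_range_factorization[OF wave_mat_carrier rk _ _ _ far_field_mat_factorization[OF B(1,2)], of "- ?P"] B(2) P
    by simp
  have "steering_vec k \<theta> N z \<in> carrier_vec N" by (simp add: steering_vec_def)
  from orth_proj_orth_compl_eq_0_iff[OF wave_mat_carrier rk this]
  show ?thesis
    by (simp add: test_fun_def Let_def range steering_vec_in_range_wave_mat_iff)
qed

section \<open>Localisation of the scatterers\<close>

theorem theorem3p3:
  fixes M :: nat
    and y :: "nat \<Rightarrow> real ^ 3"
    and \<alpha> :: "nat \<Rightarrow> complex"
    and k :: real
    and \<theta> :: "nat \<Rightarrow> real ^ 3"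
    and K :: "(real ^ 3) set"
  assumes "inj_on y {..<M}"
    and "\<And>j. j < M \<Longrightarrow> Im (\<alpha> j) \<ge> 0"
    and "k > 0"
    and "invertible_mat (foldy_mat k M y \<alpha>)"
    and "\<And>n. \<theta> n \<in> sphere 0 1"
    and "\<And>f :: real ^ 3 \<Rightarrow> complex.
           real_analytic_on f (sphere 0 1) \<Longrightarrow> (\<And>n. f (\<theta> n) = 0) \<Longrightarrow> (\<forall>x\<in>sphere 0 1. f x = 0)"
    and "compact K"
    and "y ` {..<M} \<subseteq> K"
  shows "\<exists>N\<^sub>0. \<forall>N\<ge>N\<^sub>0. N \<ge> M \<longrightarrow>
           (\<forall>z\<in>K. z \<in> y ` {..<M} \<longleftrightarrow> test_fun k M y \<alpha> \<theta> N z = \<infinity>)"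
proof -
  let ?Y = "y ` {..<M}"
  have indep: "\<forall>m\<in>I. d m = 0 \<and> b m = 0"
    if "finite I" "inj_on x I" "a \<noteq> 0"
      "\<And>n. (\<Sum>m\<in>I. (d m + b m * of_real (\<theta> n \<bullet> a)) * plane_wave k (x m) (\<theta> n)) = 0"
    for I :: "nat set" and x a d b
    using affine_plane_waves_independent_on_determining_set[OF that(1,2) assms(3) that(3) assms(6) that(4)] .
  obtain e0 :: "real ^ 3" where e0: "e0 \<noteq> 0" by (metis one_neq_zero)
  have indep0: "\<forall>m\<in>I. d m = 0" if "finite I" "inj_on x I"
      "\<And>n. (\<Sum>m\<in>I. d m * plane_wave k (x m) (\<theta> n)) = 0" for I :: "nat set" and x d
    using indep[OF that(1,2) e0, of d "\<lambda>_. 0"] that(3) by simp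
  have "\<forall>m<M. c m = 0" if "\<And>j. (\<Sum>m<M. c m * plane_wave k (y m) (\<theta> j)) = 0" for c
    using indep0[OF _ assms(1) that] by simp
  then obtain n l where l: "\<And>m m'. m < M \<Longrightarrow> m' < M \<Longrightarrow>
      (\<Sum>j<n. l m j * plane_wave k (y m') (\<theta> j)) = (if m = m' then 1 else 0)"
    using finite_dual_functionals[where M = M and e = "\<lambda>m j. plane_wave k (y m) (\<theta> j)"] by blast
  \<comment> \<open>If the steering vector of \<open>z\<close> for at least \<open>n\<close> directions is in the span of those of the
    scatterers, then its coefficients must be \<open>C m z\<close>. Hence \<open>G j z\<close> measures how far the entry \<open>j\<close> is from the
    span, with no coefficient left to choose, and it is smooth in \<open>z\<close>.\<close>
  define C where "C m z = (\<Sum>j<n. l m j * plane_wave k z (\<theta> j))" for m z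
  define G where "G j z = plane_wave k z (\<theta> j) - (\<Sum>m<M. C m z * plane_wave k (y m) (\<theta> j))" for j z
  have "\<exists>N. \<forall>z\<in>K. (\<forall>j<N. G j z = 0) \<longrightarrow> z \<in> ?Y"
  proof (rule common_zeros_determined_by_finitely_many[OF \<open>compact K\<close>])
    define D\<phi> where "D\<phi> w j a = (- \<i> * of_real k) * of_real (\<theta> j \<bullet> a) * plane_wave k w (\<theta> j)" for w j a
    define DC where "DC w m a = (\<Sum>j<n. l m j * D\<phi> w j a)" for w m a
    define D where "D j w a = D\<phi> w j a - (\<Sum>m<M. DC w m a * plane_wave k (y m) (\<theta> j))" for j w a
    have D\<phi>: "((\<lambda>z. plane_wave k z (\<theta> j)) has_derivative D\<phi> w j) (at w)" for w j
      unfolding D\<phi>_def by (rule plane_wave_derivative)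
    have G: "(G j has_derivative D j w) (at w)" for j w
      unfolding G_def C_def D_def DC_def
      by (intro has_derivative_diff has_derivative_sum has_derivative_mult_left has_derivative_mult_right D\<phi>)
    show "(G j has_derivative D j w) (at w)" for j w by (rule G)
    show "continuous_on K (G j)" for j
      by (intro continuous_at_imp_continuous_on ballI has_derivative_continuous[OF G])
    show "G j w = 0" if "w \<in> ?Y" for j w
    proof -
      obtain p where p: "p < M" "w = y p" using \<open>w \<in> ?Y\<close> by blast
      have "(\<Sum>m<M. C m w * plane_wave k (y m) (\<theta> j)) = (\<Sum>m<M. if m = p then plane_wave k (y m) (\<theta> j) else 0)"
        using p l by (intro sum.cong) (auto simp: C_def)
      then show ?thesis using p by (simp add: G_def)
    qed
    \<comment> \<open>A common zero outside \<open>?Y\<close> gives a linear relation between the waves of \<open>M + 1\<close> distinct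
      points, in which the new wave has coefficient \<open>1\<close>.\<close>
    show "z \<in> ?Y" if "\<And>j. G j z = 0" for z
    proof (rule ccontr)
      assume z: "z \<notin> ?Y"
      define x where "x = y(M := z)"
      define d where "d m = (if m = M then 1 else - C m z)" for m
      have "inj_on x {..M}"
        using assms(1) z unfolding x_def inj_on_def by (auto simp: image_iff le_less)
      moreover have "(\<Sum>m\<in>{..M}. d m * plane_wave k (x m) (\<theta> j)) = 0" for j
      proof -
        have "(\<Sum>m<M. d m * plane_wave k (x m) (\<theta> j)) = (\<Sum>m<M. - (C m z * plane_wave k (y m) (\<theta> j)))"
          by (intro sum.cong) (auto simp: d_def x_def)
        then show ?thesis using that[of j]
          by (simp add: lessThan_Suc_atMost[symmetric] sum_negf G_def d_def x_def)
      qed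
      ultimately have "d M = 0" using indep0[of "{..M}" x d] by blast
      then show False by (simp add: d_def)
    qed
    \<comment> \<open>If the derivatives of all \<open>G j\<close> at \<open>y p\<close> in direction \<open>a\<close> vanish, then \<open>(x \<bullet> a) * plane_wave k (y p) x\<close>
      is a combination of the waves, which independence forbids unless \<open>a = 0\<close>.\<close>
    show "a = 0" if "w \<in> ?Y" and D0: "\<And>j. D j w a = 0" for w a
    proof (rule ccontr)
      assume a: "a \<noteq> 0"
      obtain p where p: "p < M" "w = y p" using \<open>w \<in> ?Y\<close> by blast
      define b where "b m = (if m = p then - \<i> * of_real k else 0)" for m
      have "(\<Sum>m<M. (- DC w m a + b m * of_real (\<theta> j \<bullet> a)) * plane_wave k (y m) (\<theta> j)) = 0" for j
      proof -
        have "(\<Sum>m<M. b m * of_real (\<theta> j \<bullet> a) * plane_wave k (y m) (\<theta> j)) = (\<Sum>m<M. if m = p then D\<phi> w j a else 0)"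
          by (intro sum.cong) (auto simp: b_def D\<phi>_def p)
        then show ?thesis using D0[of j] p(1)
          by (simp add: left_diff_distrib sum_subtractf D_def)
      qed
      from indep[OF _ assms(1) a this] have "b p = 0" using p(1) by blast
      then show False using assms(3) by (simp add: b_def)
    qed
  qed
  then obtain n' where n': "\<And>z. z \<in> K \<Longrightarrow> (\<And>j. j < n' \<Longrightarrow> G j z = 0) \<Longrightarrow> z \<in> ?Y" by blast
  show ?thesis
  proof (intro exI[of _ "max n n'"] allI impI ballI)
    fix N z assume N: "N \<ge> max n n'" and z: "z \<in> K"
    have "full_column_rank (wave_mat k M y \<theta> N)"
      using N by (intro full_column_rank_wave_mat[OF l]) auto
    note test = test_fun_eq_infinity_iff[OF assms(4) this, of z]
    show "z \<in> ?Y \<longleftrightarrow> test_fun k M y \<alpha> \<theta> N z = \<infinity>"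
    proof
      assume "z \<in> ?Y"
      then obtain p where p: "p < M" "z = y p" by blast
      have "(\<Sum>m<M. (if m = p then 1 else 0) * plane_wave k (y m) (\<theta> j)) =
          (\<Sum>m<M. if m = p then plane_wave k (y m) (\<theta> j) else 0)" for j
        by (intro sum.cong) auto
      then have "\<forall>j<N. plane_wave k z (\<theta> j) = (\<Sum>m<M. (if m = p then 1 else 0) * plane_wave k (y m) (\<theta> j))"
        using p by simp
      then show "test_fun k M y \<alpha> \<theta> N z = \<infinity>" unfolding test by (rule exI[of _ "\<lambda>m. if m = p then 1 else 0"])
    next
      assume "test_fun k M y \<alpha> \<theta> N z = \<infinity>"
      then obtain c where c: "\<And>j. j < N \<Longrightarrow> plane_wave k z (\<theta> j) = (\<Sum>m<M. c m * plane_wave k (y m) (\<theta> j))"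
        unfolding test by blast
      have "C m z = c m" if "m < M" for m
      proof -
        have "C m z = (\<Sum>j<n. l m j * (\<Sum>m'<M. c m' * plane_wave k (y m') (\<theta> j)))"
          unfolding C_def using c N by (intro sum.cong) auto
        also have "\<dots> = (\<Sum>m'<M. \<Sum>j<n. l m j * (c m' * plane_wave k (y m') (\<theta> j)))"
          unfolding sum_distrib_left by (rule sum.swap)
        also have "\<dots> = (\<Sum>m'<M. c m' * (\<Sum>j<n. l m j * plane_wave k (y m') (\<theta> j)))"
          unfolding sum_distrib_left by (intro sum.cong refl) (simp add: mult_ac)
        also have "\<dots> = (\<Sum>m'<M. if m' = m then c m' else 0)"
          using l[OF that] by (intro sum.cong) auto
        finally show ?thesis using that by simp
      qed
      then have "G j z = 0" if "j < n'" for j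
        using c[of j] that N by (simp add: G_def)
      with n' z show "z \<in> ?Y" by blast
    qed
  qed
qed

end
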